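(* Let $K\ge 2$ and let $\bm p$ be a strictly positive probability distribution on triples $(a,x,y)\in\{1,\dots,K\}^3$. Let $\bm p^*$ be obtained from $\bm p$ by an intervention on both the bias $A$ and the cause $X$, i.e. for some strictly positive distributions $\bm p^*(a)$ and $\bm p^*(x)$ on $\{1,\dots,K\}$, $$\bm p^*(a,x,y)=\bm p^*(a)\,\bm p^*(x)\,\bm p(y\mid a,x)\qquad\text{for all }a,x,y$$ (equivalently, $\mathbf s_A$ is replaced by $\mathbf s_A^*$ and, for every $a$, $\mathbf s_{X|a}$ is replaced by one common vector $\mathbf s^*_X$, while $\mathbf s_{Y|A,X}$ is unchanged). Let $\delta_{\text{causal}}=\|\theta_\rightarrow^{(0)}-\theta_\rightarrow^*\|^2$ and $\delta_{\text{anticausal}}=\|\theta_\leftarrow^{(0)}-\theta_\leftarrow^*\|^2$ be the squared distances between the parameters of $\bm p$ and of $\bm p^*$ in the causal and anti-causal parametrizations. Then $$\delta_{\text{anticausal}}\ \ge\ \delta_{\text{causal}}.$$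
   Context: $A$ (bias / sensitive variable), $X$ (cause), $Y$ (effect) are categorical variables with values in $\{1,\dots,K\}$. Scores: a strictly positive distribution $(p_z)_{z=1}^K$ is represented by its score vector $\mathbf s=(s_z)_{z=1}^K\in\mathbb R^K$ with $p_z=e^{s_z}/\sum_{z'}e^{s_{z'}}$, normalized by $\sum_z s_z=0$ (so the score vector is uniquely determined by the distribution). For a joint distribution $\bm p(a,x,y)$ write $\mathbf s_A=(s_a)_a$ for the score of the marginal $\bm p(a)$; $\mathbf s_{X|a}=(s_{x|a})_x$ for the score of $\bm p(x\mid a)$; $\mathbf s_{Y|a}=(s_{y|a})_y$ for the score of $\bm p(y\mid a)$; $\mathbf s_{Y|a,x}=(s_{y|a,x})_y$ for the score of $\bm p(y\mid a,x)$; $\mathbf s_{X|a,y}=(s_{x|a,y})_x$ for the score of $\bm p(x\mid a,y)$. Each of these vectors sums to zero. Starred quantities are the corresponding scores of $\bm p^*$. Causal parametrization (factorization $\bm p(a)\bm p(x|a)\bm p(y|a,x)$): $\theta_\rightarrow=(\mathbf s_A,(\mathbf s_{X|a})_a,(\mathbf s_{Y|a,x})_{a,x})$. Anti-causal parametrization (factorization $\bm p(a)\bm p(y|a)\bm p(x|a,y)$): $\theta_\leftarrow=(\mathbf s_A,(\mathbf s_{Y|a})_a,(\mathbf s_{X|a,y})_{a,y})$. The superscript $(0)$ denotes the parameters of $\bm p$ and the superscript $*$ those of $\bm p^*$. Norms are Euclidean norms over all coordinates, so that $$\delta_{\text{causal}}=\|\mathbf s_A-\mathbf s_A^*\|^2+\sum_a\|\mathbf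 s_{X|a}-\mathbf s^*_{X|a}\|^2+\sum_{a,x}\|\mathbf s_{Y|a,x}-\mathbf s^*_{Y|a,x}\|^2,$$ $$\delta_{\text{anticausal}}=\|\mathbf s_A-\mathbf s_A^*\|^2+\sum_a\|\mathbf s_{Y|a}-\mathbf s^*_{Y|a}\|^2+\sum_{a,y}\|\mathbf s_{X|a,y}-\mathbf s^*_{X|a,y}\|^2.$$ *)

theory Defs
  imports "HOL-Probability.Probability"
begin

text \<open>
  The finite type \<open>'k\<close> plays the role of \<open>{1,\<dots>,K}\<close>, with \<open>K = CARD('k)\<close>; a joint
  distribution of \<open>(A, X, Y)\<close> is a pmf on \<open>'k \<times> 'k \<times> 'k\<close>, in this order.
\<close>

definition is_score :: "'k::finite pmf \<Rightarrow> real ^ 'k \<Rightarrow> bool" where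
  "is_score q s \<longleftrightarrow>
     (\<Sum>z\<in>UNIV. s $ z) = 0 \<and>
     (\<forall>z. pmf q z = exp (s $ z) / (\<Sum>z'\<in>UNIV. exp (s $ z')))"

text \<open>Meaningful only for strictly positive \<open>q\<close>; see \<open>is_score_ex1\<close>.\<close>

definition score :: "'k::finite pmf \<Rightarrow> real ^ 'k" where
  "score q = (THE s. is_score q s)"

lemma is_score_ex1:
  fixes q :: "'k::finite pmf"
  assumes "set_pmf q = UNIV"
  shows "\<exists>!s. is_score q s"
proof
  have pos: "pmf q z > 0" for z
    using assms by (simp add: pmf_positive)
  have total: "(\<Sum>z\<in>UNIV. pmf q z) = 1"
    by (rule sum_pmf_eq_1) auto
  let ?m = "(\<Sum>z\<in>UNIV. ln (pmf q z)) / CARD('k)"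
  have e: "exp (ln (pmf q z) - ?m) = pmf q z / exp ?m" for z
    using pos[of z] by (simp add: exp_diff)
  show "is_score q (\<chi> z. ln (pmf q z) - ?m)"
    using total by (simp add: is_score_def e sum_subtractf flip: sum_divide_distrib)
next
  fix s
  assume s: "is_score q s"
  let ?L = "ln (\<Sum>z\<in>UNIV. exp (s $ z))"
  have Z: "(\<Sum>z\<in>UNIV. exp (s $ z)) > 0"
    by (intro sum_pos) auto
  have l: "ln (pmf q z) = s $ z - ?L" for z
  proof -
    have "pmf q z = exp (s $ z) / (\<Sum>z\<in>UNIV. exp (s $ z))"
      using s by (auto simp: is_score_def)
    then show ?thesis
      using Z by (simp add: ln_div)
  qed
  have "(\<Sum>z\<in>UNIV. ln (pmf q z)) = - (CARD('k) * ?L)"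
    unfolding l using s by (simp add: sum_subtractf is_score_def)
  then show "s = (\<chi> z. ln (pmf q z) - (\<Sum>z\<in>UNIV. ln (pmf q z)) / CARD('k))"
    by (simp add: vec_eq_iff l)
qed

definition marg_A :: "('k \<times> 'k \<times> 'k) pmf \<Rightarrow> 'k pmf" where
  "marg_A p = map_pmf (\<lambda>(a, x, y). a) p"

definition cond_X_A :: "('k \<times> 'k \<times> 'k) pmf \<Rightarrow> 'k \<Rightarrow> 'k pmf" where
  "cond_X_A p a = map_pmf (\<lambda>(a', x, y). x) (cond_pmf p {(a', x, y). a' = a})"

definition cond_Y_A :: "('k \<times> 'k \<times> 'k) pmf \<Rightarrow> 'k \<Rightarrow> 'k pmf" where
  "cond_Y_A p a = map_pmf (\<lambda>(a', x, y). y) (cond_pmf p {(a', x, y). a' = a})"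

definition cond_Y_AX :: "('k \<times> 'k \<times> 'k) pmf \<Rightarrow> 'k \<Rightarrow> 'k \<Rightarrow> 'k pmf" where
  "cond_Y_AX p a x =
     map_pmf (\<lambda>(a', x', y). y) (cond_pmf p {(a', x', y). a' = a \<and> x' = x})"

definition cond_X_AY :: "('k \<times> 'k \<times> 'k) pmf \<Rightarrow> 'k \<Rightarrow> 'k \<Rightarrow> 'k pmf" where
  "cond_X_AY p a y =
     map_pmf (\<lambda>(a', x, y'). x) (cond_pmf p {(a', x, y'). a' = a \<and> y' = y})"

text \<open>
  The norms of product types and of \<open>'a ^ 'k\<close> are Euclidean, so the norm on the parameter
  type below is the Euclidean norm over all coordinates; see \<open>delta_causal_expand\<close> and
  \<open>delta_anticausal_expand\<close>.
\<close>

type_synonym 'k params = "(real ^ 'k) \<times> (real ^ 'k ^ 'k) \<times> (real ^ 'k ^ 'k ^ 'k)"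

definition theta_causal :: "('k::finite \<times> 'k \<times> 'k) pmf \<Rightarrow> 'k params" where
  "theta_causal p =
     (score (marg_A p), \<chi> a. score (cond_X_A p a), \<chi> a x. score (cond_Y_AX p a x))"

definition theta_anticausal :: "('k::finite \<times> 'k \<times> 'k) pmf \<Rightarrow> 'k params" where
  "theta_anticausal p =
     (score (marg_A p), \<chi> a. score (cond_Y_A p a), \<chi> a y. score (cond_X_AY p a y))"

definition delta_causal ::
    "('k::finite \<times> 'k \<times> 'k) pmf \<Rightarrow> ('k \<times> 'k \<times> 'k) pmf \<Rightarrow> real" where
  "delta_causal p p' = (norm (theta_causal p - theta_causal p'))\<^sup>2"

definition delta_anticausal ::
    "('k::finite \<times> 'k \<times> 'k) pmf \<Rightarrow> ('k \<times> 'k \<times> 'k) pmf \<Rightarrow> real" where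
  "delta_anticausal p p' = (norm (theta_anticausal p - theta_anticausal p'))\<^sup>2"

lemma norm_vec_power2: "(norm (v :: 'a::real_normed_vector ^ 'k))\<^sup>2 = (\<Sum>i\<in>UNIV. (norm (v $ i))\<^sup>2)"
  by (simp add: norm_vec_def L2_set_def sum_nonneg)

lemma norm_Pair_power2: "(norm (u, v))\<^sup>2 = (norm u)\<^sup>2 + (norm v)\<^sup>2"
  by (simp add: norm_Pair)

lemma delta_causal_expand:
  "delta_causal p p' =
     (norm (score (marg_A p) - score (marg_A p')))\<^sup>2
     + (\<Sum>a\<in>UNIV. (norm (score (cond_X_A p a) - score (cond_X_A p' a)))\<^sup>2)
     + (\<Sum>a\<in>UNIV. \<Sum>x\<in>UNIV. (norm (score (cond_Y_AX p a x) - score (cond_Y_AX p' a x)))\<^sup>2)"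
  by (simp add: delta_causal_def theta_causal_def norm_Pair_power2 norm_vec_power2)

lemma delta_anticausal_expand:
  "delta_anticausal p p' =
     (norm (score (marg_A p) - score (marg_A p')))\<^sup>2
     + (\<Sum>a\<in>UNIV. (norm (score (cond_Y_A p a) - score (cond_Y_A p' a)))\<^sup>2)
     + (\<Sum>a\<in>UNIV. \<Sum>y\<in>UNIV. (norm (score (cond_X_AY p a y) - score (cond_X_AY p' a y)))\<^sup>2)"
  by (simp add: delta_anticausal_def theta_anticausal_def norm_Pair_power2 norm_vec_power2)

end

(* Write p(a,x,y) = P(a,x) c(a,x,y) with c = p(y|a,x), which the intervention leaves alone. Up to a
   factor that does not depend on x, the factor c is the only difference between p(x|a,y) and
   p(x|a), and it is common to p and p'. Hence the centred log-probabilities satisfy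
   s_{X|a,y} - s*_{X|a,y} = s_{X|a} - s*_X for every y, so the anti-causal distance counts
   each |s_{X|a} - s*_X|^2 K times, the causal one once. *)
theory Submission imports Defs begin

text \<open>The factor \<open>c\<close> adds the same \<open>ln c\<close> to every log-probability,
  and centring removes it. Scores can thus be read off from unnormalised weights \<open>w\<close>,
  with no normalising constant computed.\<close>

lemma score_eq_centred_ln:
  fixes q :: "'k::finite pmf"
  assumes "c > 0" and "\<And>z. w z > 0" and "\<And>z. pmf q z = c * w z"
  shows "score q = (\<chi> z. ln (w z) - (\<Sum>z'\<in>UNIV. ln (w z')) / CARD('k))"
proof -
  let ?m = "(\<Sum>z\<in>UNIV. ln (w z)) / CARD('k)"
  let ?s = "\<chi> z. ln (w z) - ?m"
  \<comment> \<open>Full support gives uniqueness of the score, without which the \<open>THE\<close>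
    in \<open>score\<close> could not be evaluated.\<close>
  have "pmf q z \<noteq> 0" for z
    using assms(1) assms(2)[of z] by (simp add: assms(3))
  then have full: "set_pmf q = UNIV"
    by (auto simp: set_pmf_eq)
  have "(\<Sum>z\<in>UNIV. pmf q z) = 1"
    by (rule sum_pmf_eq_1) auto
  \<comment> \<open>This identifies \<open>c\<close> as the reciprocal of the total weight, so
    \<open>q\<close> is exactly \<open>w\<close> normalised.\<close>
  then have total: "c * (\<Sum>z\<in>UNIV. w z) = 1"
    by (simp add: assms(3) sum_distrib_left)
  then have nz: "(\<Sum>z\<in>UNIV. w z) \<noteq> 0"
    by auto
  have e: "exp (ln (w z) - ?m) = w z / exp ?m" for z
    using assms(2)[of z] by (simp add: exp_diff)
  have "pmf q z = w z / (\<Sum>z'\<in>UNIV. w z')" for z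
    using total nz by (simp add: assms(3) field_simps)
  then have "is_score q ?s"
    by (simp add: is_score_def e sum_subtractf flip: sum_divide_distrib)
  then show ?thesis
    unfolding score_def using is_score_ex1[OF full] by (intro the1_equality)
qed

lemma pmf_map_cond_pmf:
  assumes "set_pmf p \<inter> S \<noteq> {}"
  shows "pmf (map_pmf f (cond_pmf p S)) x =
    measure (measure_pmf p) (S \<inter> f -` {x}) / measure (measure_pmf p) S"
proof -
  have "measure (measure_pmf p) S > 0"
    using assms by (auto intro: measure_pmf_posI)
  then show ?thesis
    unfolding pmf_map cond_pmf.rep_eq[OF assms]
    by (subst measure_uniform_measure) (auto simp: measure_pmf.emeasure_eq_measure)
qed

context
  fixes p :: "('k::finite \<times> 'k \<times> 'k) pmf"
  assumes full: "set_pmf p = UNIV"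
begin

lemma prob_pos: "S \<noteq> {} \<Longrightarrow> measure (measure_pmf p) S > 0"
  using full by (auto intro: measure_pmf_posI)

lemma pmf_cond_Y_AX:
  "pmf (cond_Y_AX p a x) y =
    pmf p (a, x, y) / measure (measure_pmf p) {(a', x', y). a' = a \<and> x' = x}"
proof -
  have "{(a', x', y). a' = a \<and> x' = x} \<inter> (\<lambda>(a', x', y). y) -` {y} = {(a, x, y)}"
    by auto
  then show ?thesis
    unfolding cond_Y_AX_def using full by (subst pmf_map_cond_pmf) (auto simp: pmf.rep_eq)
qed

lemma pmf_cond_X_AY:
  "pmf (cond_X_AY p a y) x =
    pmf p (a, x, y) / measure (measure_pmf p) {(a', x, y'). a' = a \<and> y' = y}"
proof -
  have "{(a', x, y'). a' = a \<and> y' = y} \<inter> (\<lambda>(a', x, y'). x) -` {x} = {(a, x, y)}"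
    by auto
  then show ?thesis
    unfolding cond_X_AY_def using full by (subst pmf_map_cond_pmf) (auto simp: pmf.rep_eq)
qed

lemma pmf_cond_X_A:
  "pmf (cond_X_A p a) x =
    measure (measure_pmf p) {(a', x', y). a' = a \<and> x' = x} /
    measure (measure_pmf p) {(a', x, y). a' = a}"
proof -
  have eq: "{(a', x, y). a' = a} \<inter> (\<lambda>(a', x, y). x) -` {x} =
      {(a' :: 'k, x' :: 'k, y :: 'k). a' = a \<and> x' = x}"
    by auto
  have ne: "set_pmf p \<inter> {(a', x, y). a' = a} \<noteq> {}"
    using full by auto
  show ?thesis
    unfolding cond_X_A_def pmf_map_cond_pmf[OF ne] eq ..
qed

lemma pmf_cond_Y_AX_pos: "pmf (cond_Y_AX p a x) y > 0"
  using full by (auto simp: pmf_cond_Y_AX intro!: divide_pos_pos prob_pos pmf_positive)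

text \<open>Serves both distributions with the same kernel \<open>c\<close>. Only \<open>c\<close>
  has to be normalised: summing over y then leaves \<open>u a * v a x\<close> as the joint mass of
  (a, x), while the scale of \<open>v a\<close> disappears under centring.\<close>

lemma score_product_form:
  assumes "\<And>a. u a > 0" and "\<And>a x. v a x > 0" and "\<And>a x y. c a x y > 0"
    and "\<And>a x. (\<Sum>y\<in>UNIV. c a x y) = 1"
    and p: "\<And>a x y. pmf p (a, x, y) = u a * v a x * c a x y"
  shows "score (cond_X_A p a) = (\<chi> x. ln (v a x) - (\<Sum>z\<in>UNIV. ln (v a z)) / CARD('k))"
    and "pmf (cond_Y_AX p a x) y = c a x y"
    and "score (cond_X_AY p a y) =
      (\<chi> x. ln (v a x) + ln (c a x y) - (\<Sum>z\<in>UNIV. ln (v a z) + ln (c a z y)) / CARD('k))"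
proof -
  have P: "measure (measure_pmf p) {(a', x', y). a' = a \<and> x' = x} = u a * v a x" for a x
  proof -
    have "{(a', x', y :: 'k). a' = a \<and> x' = x} = (\<lambda>y. (a, x, y)) ` UNIV"
      by auto
    then have "measure (measure_pmf p) {(a', x', y). a' = a \<and> x' = x}
        = (\<Sum>z\<in>(\<lambda>y. (a, x, y)) ` UNIV. pmf p z)"
      by (simp only: measure_measure_pmf_finite[OF finite])
    also have "\<dots> = (\<Sum>y\<in>UNIV. u a * v a x * c a x y)"
      by (subst sum.reindex) (auto simp: inj_on_def p)
    finally show ?thesis
      using assms(4) by (simp flip: sum_distrib_left)
  qed
  let ?MA = "measure (measure_pmf p) {(a', x, y). a' = a}"
  let ?MAY = "measure (measure_pmf p) {(a', x, y'). a' = a \<and> y' = y}"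
  \<comment> \<open>These ratios do not depend on x, so they act as the constant in
    \<open>score_eq_centred_ln\<close>; the remaining weights are \<open>v a x\<close> and
    \<open>v a x * c a x y\<close>.\<close>
  have "u a / ?MA > 0" "u a / ?MAY > 0"
    using assms(1) by (auto intro!: divide_pos_pos prob_pos)
  note scale = this
  have "pmf (cond_X_A p a) x = u a / ?MA * v a x" for x
    unfolding pmf_cond_X_A P by simp
  then show "score (cond_X_A p a) = (\<chi> x. ln (v a x) - (\<Sum>z\<in>UNIV. ln (v a z)) / CARD('k))"
    by (rule score_eq_centred_ln[OF scale(1) assms(2)])
  show "pmf (cond_Y_AX p a x) y = c a x y"
    unfolding pmf_cond_Y_AX P p using assms(1)[of a] assms(2)[of a x] by simp
  have "score (cond_X_AY p a y) =
      (\<chi> x. ln (v a x * c a x y) - (\<Sum>z\<in>UNIV. ln (v a z * c a z y)) / CARD('k))"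
    by (rule score_eq_centred_ln[OF scale(2)]) (simp_all add: assms(2,3) pmf_cond_X_AY p)
  moreover have "ln (v a x * c a x y) = ln (v a x) + ln (c a x y)" for x
    using assms(2)[of a x] assms(3)[of a x y] by (simp add: ln_mult)
  ultimately show "score (cond_X_AY p a y) =
      (\<chi> x. ln (v a x) + ln (c a x y) - (\<Sum>z\<in>UNIV. ln (v a z) + ln (c a z y)) / CARD('k))"
    by simp
qed

end

theorem mainTheorem3:
  fixes p p' :: "('k::finite \<times> 'k \<times> 'k) pmf"
    and qA qX :: "'k pmf"
  assumes "CARD('k) \<ge> 2"
    and "set_pmf p = UNIV"
    and "set_pmf qA = UNIV"
    and "set_pmf qX = UNIV"
    and "\<And>a x y. pmf p' (a, x, y) = pmf qA a * pmf qX x * pmf (cond_Y_AX p a x) y"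
  shows "delta_anticausal p p' \<ge> delta_causal p p'"
proof -
  let ?c = "\<lambda>a x y. pmf (cond_Y_AX p a x) y"
  let ?P = "\<lambda>a x. measure (measure_pmf p) {(a', x', y). a' = a \<and> x' = x}"
  have c_pos: "?c a x y > 0" for a x y
    by (rule pmf_cond_Y_AX_pos[OF assms(2)])
  have c_sum: "(\<Sum>y\<in>UNIV. ?c a x y) = 1" for a x
    by (rule sum_pmf_eq_1) auto
  have P_pos: "?P a x > 0" for a x
    by (rule prob_pos[OF assms(2)]) auto
  have p_eq: "pmf p (a, x, y) = 1 * ?P a x * ?c a x y" for a x y
    using P_pos[of a x] by (simp add: pmf_cond_Y_AX[OF assms(2)])
  have q_pos: "pmf qA a > 0" "pmf qX x > 0" for a x
    using assms(3,4) by (simp_all add: pmf_positive)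
  have "pmf p' (a, x, y) > 0" for a x y
    using q_pos c_pos by (simp add: assms(5))
  then have full': "set_pmf p' = UNIV"
    by (auto simp: set_pmf_eq less_le)
  \<comment> \<open>For \<open>p\<close> the whole joint mass of (a, x) is taken as
    \<open>v\<close>, which avoids splitting it into p(a) and p(x|a).\<close>
  note S = score_product_form[OF assms(2), where u = "\<lambda>_. 1" and v = ?P and c = ?c,
      OF _ P_pos c_pos c_sum p_eq, simplified]
  note S' = score_product_form[OF full', where u = "pmf qA" and v = "\<lambda>_. pmf qX" and c = ?c,
      OF q_pos c_pos c_sum assms(5)]
  let ?d = "\<lambda>a. (norm (score (cond_X_A p a) - score (cond_X_A p' a)))\<^sup>2"
  \<comment> \<open>The mechanism of Y survives the intervention, so the third block of the causal
    distance vanishes.\<close>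
  have "cond_Y_AX p' a x = cond_Y_AX p a x" for a x
    by (simp add: pmf_eq_iff S'(2))
  then have causal: "delta_causal p p' =
      (norm (score (marg_A p) - score (marg_A p')))\<^sup>2 + (\<Sum>a\<in>UNIV. ?d a)"
    by (simp add: delta_causal_expand)
  \<comment> \<open>The terms \<open>ln (?c a x y)\<close> and their mean over x cancel. The right
    side is free of y, so the sum over y yields the factor \<open>CARD('k)\<close> below.\<close>
  have "score (cond_X_AY p a y) - score (cond_X_AY p' a y) =
      score (cond_X_A p a) - score (cond_X_A p' a)" for a y
    by (simp add: S(1,3) S'(1,3) vec_eq_iff sum.distrib add_divide_distrib)
  then have anticausal: "delta_anticausal p p' =
      (norm (score (marg_A p) - score (marg_A p')))\<^sup>2
      + (\<Sum>a\<in>UNIV. (norm (score (cond_Y_A p a) - score (cond_Y_A p' a)))\<^sup>2)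
      + (\<Sum>a\<in>UNIV. CARD('k) * ?d a)"
    by (simp add: delta_anticausal_expand)
  have "?d a \<le> CARD('k) * ?d a" for a
    using assms(1) mult_right_mono[of 1 "real CARD('k)" "?d a"] by simp
  then have "(\<Sum>a\<in>UNIV. ?d a) \<le> (\<Sum>a\<in>UNIV. CARD('k) * ?d a)"
    by (rule sum_mono)
  \<comment> \<open>The change in p(y|a) has no causal counterpart; its sign is all that
    matters.\<close>
  moreover have "(\<Sum>a\<in>UNIV. (norm (score (cond_Y_A p a) - score (cond_Y_A p' a)))\<^sup>2) \<ge> 0"
    by (simp add: sum_nonneg)
  ultimately show ?thesis
    unfolding causal anticausal by linarith
qed

end
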